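(* Let $Q_1$ and $P_2$ be non-constant complex polynomials, and let $P_1$ be a non-zero complex polynomial (possibly constant). Then the entire function $$F_2(z)=P_1(z)\exp(Q_1(z))+P_2(z)$$ has Baker omitted value (at $\infty$).
   Context: A point $a\in\widehat{\mathbb C}$ is an omitted value of an entire function $f:\mathbb C\to\mathbb C$ if $f(z)\neq a$ for every $z\in\mathbb C$; the point $\infty$ is always an omitted value of a transcendental entire function. An omitted value $a\in\widehat{\mathbb C}$ of an entire function $f$ is called a Baker omitted value (bov) of $f$ if there is a disk $D$ (in the spherical metric) centered at $a$ such that $f^{-1}(D)\subset\mathbb C$ is infinitely connected (i.e. it is a domain, in particular connected, of infinite connectivity) and each connected component of the boundary of $f^{-1}(D)$ (boundary taken in $\mathbb C$) is bounded. Saying that an entire function "has bov" means that $\infty$ is a Baker omitted value of it. *)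

theory Defs
  imports "HOL-Analysis.Analysis" "HOL-Computational_Algebra.Polynomial"
begin

text \<open>The extended complex plane: \<open>Some z\<close> is the finite point \<open>z\<close>, and \<open>None\<close> is the point
  at infinity. The Alexandroff compactification gives it the topology of the Riemann sphere.\<close>

type_synonym ecomplex = "complex option"

abbreviation riemann_sphere :: "ecomplex topology" where
  "riemann_sphere \<equiv> Alexandroff_compactification (euclidean :: complex topology)"

text \<open>Chordal distance: the Euclidean distance in \<open>\<real>\<^sup>3\<close> between the stereographic images on the
  unit sphere.\<close>

fun chordal_dist :: "ecomplex \<Rightarrow> ecomplex \<Rightarrow> real" where
  "chordal_dist (Some z) (Some w) =
     2 * cmod (z - w) / (sqrt (1 + (cmod z)\<^sup>2) * sqrt (1 + (cmod w)\<^sup>2))"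
| "chordal_dist (Some z) None = 2 / sqrt (1 + (cmod z)\<^sup>2)"
| "chordal_dist None (Some w) = 2 / sqrt (1 + (cmod w)\<^sup>2)"
| "chordal_dist None None = 0"

text \<open>Great-circle distance on the unit sphere, i.e. the metric with length element
  \<open>2 |dz| / (1 + |z|\<^sup>2)\<close>; its diameter is \<open>pi\<close>.\<close>

definition spherical_dist :: "ecomplex \<Rightarrow> ecomplex \<Rightarrow> real" where
  "spherical_dist x y = 2 * arcsin (chordal_dist x y / 2)"

definition spherical_ball :: "ecomplex \<Rightarrow> real \<Rightarrow> ecomplex set" where
  "spherical_ball a r = {x. spherical_dist a x < r}"

text \<open>As \<open>R\<close> runs through the positive reals, the radius below runs through \<open>(0, pi)\<close>; so the
  disks about infinity are the exteriors of the disks \<open>cball 0 R\<close>.\<close>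

lemma Some_in_spherical_ball_None:
  assumes "0 \<le> R"
  shows "Some z \<in> spherical_ball None (2 * arcsin (1 / sqrt (1 + R\<^sup>2))) \<longleftrightarrow> R < cmod z"
proof -
  have pos: "0 < sqrt (1 + x\<^sup>2)" for x :: real
    by (simp add: add_pos_nonneg)
  have *: "\<bar>1 / sqrt (1 + x\<^sup>2)\<bar> \<le> 1" for x :: real
  proof -
    have "1 \<le> sqrt (1 + x\<^sup>2)" by simp
    then have "1 / sqrt (1 + x\<^sup>2) \<le> 1 / 1"
      using pos[of x] by (intro divide_left_mono) auto
    then show ?thesis using pos[of x] by (simp only: abs_of_pos zero_less_divide_1_iff)
  qed
  have "Some z \<in> spherical_ball None (2 * arcsin (1 / sqrt (1 + R\<^sup>2)))
      \<longleftrightarrow> arcsin (1 / sqrt (1 + (cmod z)\<^sup>2)) < arcsin (1 / sqrt (1 + R\<^sup>2))"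
    by (simp add: spherical_ball_def spherical_dist_def)
  also have "\<dots> \<longleftrightarrow> 1 / sqrt (1 + (cmod z)\<^sup>2) < 1 / sqrt (1 + R\<^sup>2)"
    using *[of "cmod z"] *[of R] by (intro arcsin_less_mono) auto
  also have "\<dots> \<longleftrightarrow> sqrt (1 + R\<^sup>2) < sqrt (1 + (cmod z)\<^sup>2)"
    using pos[of R] pos[of "cmod z"] by (simp del: real_sqrt_gt_0_iff add: field_simps)
  also have "\<dots> \<longleftrightarrow> R\<^sup>2 < (cmod z)\<^sup>2" by simp
  also have "\<dots> \<longleftrightarrow> R < cmod z"
    using assms by (metis abs_norm_cancel abs_of_nonneg abs_le_square_iff not_le)
  finally show ?thesis .
qed

text \<open>The connectivity of a plane domain is the number of components of its complement in the
  sphere (not in the plane).\<close>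

definition infinitely_connected :: "complex set \<Rightarrow> bool" where
  "infinitely_connected U \<longleftrightarrow>
     open U \<and> U \<noteq> {} \<and> connected U \<and>
     infinite (connected_components_of
       (subtopology riemann_sphere (topspace riemann_sphere - Some ` U)))"

definition omitted_value :: "(complex \<Rightarrow> complex) \<Rightarrow> ecomplex \<Rightarrow> bool" where
  "omitted_value f a \<longleftrightarrow> (\<forall>z. Some (f z) \<noteq> a)"

text \<open>The radius is below \<open>pi\<close> so that the ball is a genuine disk: the ball of radius \<open>pi\<close>
  is the sphere minus the antipode of \<open>a\<close>.\<close>

definition baker_omitted_value :: "(complex \<Rightarrow> complex) \<Rightarrow> ecomplex \<Rightarrow> bool" where
  "baker_omitted_value f a \<longleftrightarrow>
     f holomorphic_on UNIV \<and> omitted_value f a \<and>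
     (\<exists>r. 0 < r \<and> r < pi \<and>
        (let U = {z. Some (f z) \<in> spherical_ball a r}
         in infinitely_connected U \<and> (\<forall>C \<in> components (frontier U). bounded C)))"

definition has_bov :: "(complex \<Rightarrow> complex) \<Rightarrow> bool" where
  "has_bov f \<longleftrightarrow> baker_omitted_value f None"

end

theory Submission
  imports Defs "HOL-Complex_Analysis.Complex_Analysis"
begin

text \<open>
  Write \<open>f = P\<^sub>1 exp(Q) + P\<^sub>2\<close> and consider the sublevel set \<open>K = {|f| \<le> R}\<close>; the level
  \<open>R > 0\<close> is arbitrary. The complement of \<open>K\<close> is the preimage of a disk about infinity, and
  all that is needed about \<open>f\<close> is that \<open>K\<close> is unbounded while each of its components is
  bounded. The rest is plane topology (\<open>has_bov_if_sublevel\<close>):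

  \<^item> If two points of the superlevel set were separated by \<open>K\<close>, then already by a single component of
    \<open>K\<close>. That component is bounded, so one of the two points lies in a bounded region whose frontier
    belongs to \<open>K\<close>, and the maximum principle puts the point into \<open>K\<close>, a contradiction. So the
    superlevel set is connected (\<open>connected_superlevel\<close>).

  \<^item> In the sphere, a compact component of \<open>K\<close> can be enclosed in a compact relatively open
    subset of \<open>K\<close>, which separates it from infinity. So \<open>{\<infinity>}\<close> is a component of
    \<open>K \<union> {\<infinity>}\<close>. With finitely many components it would be isolated, but \<open>K\<close> is unbounded
    (\<open>infinitely_connected_if_complement_components_bounded\<close>).

  \<^item> Each component of the frontier of the superlevel set lies in a component of \<open>K\<close>.

  \<open>K\<close> is unbounded because infinity is an essential singularity. Otherwise \<open>f\<close> would be a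
  polynomial by the theorems of Casorati-Weierstrass and Liouville
  (\<open>unbounded_sublevel_if_not_poly\<close>), and so would be \<open>P\<^sub>1 exp(Q)\<close>, which a comparison of
  degrees in its differential equation excludes (\<open>poly_times_exp_not_poly\<close>).

  Boundedness of the components is where the non-constant \<open>P\<^sub>2\<close> enters. Far out,
  \<open>|P\<^sub>2|\<close> is large compared with \<open>R\<close>, so on \<open>K\<close> the quotient \<open>g = P\<^sub>1 exp(Q) / P\<^sub>2\<close> is
  close to \<open>-1\<close>. On the scale \<open>1 / |Q'(z)|\<close> the rational factor of \<open>g\<close> is nearly constant and \<open>Q\<close>
  nearly linear, so \<open>g\<close> behaves like \<open>- exp(w)\<close> with \<open>w = (\<zeta> - z) Q'(z)\<close>. On the circle \<open>|w| = 1\<close>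
  the value \<open>exp(w)\<close> stays away from \<open>1\<close>, so the circle of radius \<open>1 / |Q'(z)|\<close> about a far
  point \<open>z\<close> of \<open>K\<close> misses \<open>K\<close> and encloses the component of \<open>z\<close>
  (\<open>far_sublevel_points_encircled\<close>).
\<close>

section \<open>Polynomials near infinity\<close>

lemma eventually_poly_neq_0_at_infinity:
  fixes p :: "'a::real_normed_field poly"
  assumes "p \<noteq> 0"
  shows "\<forall>\<^sub>F z in at_infinity. poly p z \<noteq> 0"
proof -
  have "finite {z. poly p z = 0}" using assms by (rule poly_roots_finite)
  then have "bounded {z. poly p z = 0}" by (rule finite_imp_bounded)
  then obtain B where "\<And>z. poly p z = 0 \<Longrightarrow> norm z \<le> B"
    by (auto simp: bounded_iff)
  then show ?thesis
    by (intro eventually_at_infinityI[of "B + 1"]) force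
qed

text \<open>A polynomial is asymptotic to its leading term, so asymptotically equal arguments going to
  infinity give asymptotically equal values.\<close>

lemma poly_ratio_tendsto_1:
  fixes p :: "'a::real_normed_field poly"
  assumes "p \<noteq> 0" and x: "filterlim x at_infinity F"
    and yx: "((\<lambda>n. y n / x n) \<longlongrightarrow> 1) F"
  shows "((\<lambda>n. poly p (y n) / poly p (x n)) \<longlongrightarrow> 1) F"
proof -
  let ?d = "degree p" and ?c = "lead_coeff p"
  have x0: "\<forall>\<^sub>F n in F. x n \<noteq> 0"
    using x by (rule filterlim_at_infinity_imp_eventually_ne)
  have "filterlim (\<lambda>n. y n / x n * x n) at_infinity F"
    by (rule tendsto_mult_filterlim_at_infinity[OF yx _ x]) simp
  then have y: "filterlim y at_infinity F"
    by (rule filterlim_mono_eventually) (use x0 in \<open>auto elim: eventually_mono\<close>)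
  have y0: "\<forall>\<^sub>F n in F. y n \<noteq> 0"
    using y by (rule filterlim_at_infinity_imp_eventually_ne)
  have "((\<lambda>n. (y n / x n) ^ ?d * ((poly p (y n) / y n ^ ?d) / (poly p (x n) / x n ^ ?d)))
      \<longlongrightarrow> 1 ^ ?d * (?c / ?c)) F"
    using \<open>p \<noteq> 0\<close>
    by (intro tendsto_intros yx filterlim_compose[OF poly_divide_tendsto_aux] x y) simp
  then have "((\<lambda>n. (y n / x n) ^ ?d * ((poly p (y n) / y n ^ ?d) / (poly p (x n) / x n ^ ?d)))
      \<longlongrightarrow> 1) F"
    using \<open>p \<noteq> 0\<close> by simp
  then show ?thesis
    by (rule Lim_transform_eventually)
      (use x0 y0 in eventually_elim, simp add: field_simps)
qed

text \<open>A displacement of length \<open>1 / |q'(x)|\<close> is the scale on which the linear part of \<open>q\<close> changes by a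
  unit. It is small compared with \<open>x\<close>, because \<open>x q'(x)\<close> is a non-constant polynomial in \<open>x\<close>; hence
  \<open>q'\<close> is nearly constant along the displacement and the remainder of the linearization vanishes in
  the limit.\<close>

lemma poly_increment_linear:
  fixes q :: "complex poly"
  assumes "degree q > 0" and x: "filterlim x at_infinity F"
    and u: "\<And>n. norm (u n) = 1 / norm (poly (pderiv q) (x n))"
  shows "((\<lambda>n. u n / x n) \<longlongrightarrow> 0) F"
    and "((\<lambda>n. poly q (x n + u n) - poly q (x n) - u n * poly (pderiv q) (x n)) \<longlongrightarrow> 0) F"
proof -
  let ?q' = "poly (pderiv q)"
  have q'0: "pderiv q \<noteq> 0"
    using \<open>degree q > 0\<close> by (simp add: pderiv_eq_0_iff)
  have x0: "\<forall>\<^sub>F n in F. x n \<noteq> 0"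
    using x by (rule filterlim_at_infinity_imp_eventually_ne)
  have "filterlim (poly (pCons 0 (pderiv q))) at_infinity at_infinity"
    using q'0 by (intro filterlim_poly_at_infinity) simp
  then have xq': "filterlim (\<lambda>n. x n * ?q' (x n)) at_infinity F"
    using filterlim_compose[OF _ x, of "poly (pCons 0 (pderiv q))"] by simp
  have q'x0: "\<forall>\<^sub>F n in F. ?q' (x n) \<noteq> 0"
    using eventually_poly_neq_0_at_infinity[OF q'0] x by (rule eventually_compose_filterlim)
  have "((\<lambda>n. inverse (x n * ?q' (x n))) \<longlongrightarrow> 0) F"
    using xq' by (rule filterlim_compose[OF tendsto_inverse_0])
  then have "((\<lambda>n. norm (inverse (x n * ?q' (x n)))) \<longlongrightarrow> 0) F"
    by (rule tendsto_norm_zero)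
  moreover have "norm (inverse (x n * ?q' (x n))) = norm (u n / x n)" for n
    by (simp add: u norm_divide norm_mult norm_inverse divide_simps)
  ultimately have ux: "((\<lambda>n. norm (u n / x n)) \<longlongrightarrow> 0) F"
    by simp
  then show ux0: "((\<lambda>n. u n / x n) \<longlongrightarrow> 0) F"
    by (rule tendsto_norm_zero_cancel)

  \<comment> \<open>The mean value inequality on the segment needs the largest deviation of the derivative; the
    point where it is attained is again asymptotic to the base point.\<close>
  have "\<exists>v\<in>closed_segment (x n) (x n + u n). \<forall>z\<in>closed_segment (x n) (x n + u n).
      norm (?q' z - ?q' (x n)) \<le> norm (?q' v - ?q' (x n))" for n
    by (rule continuous_attains_sup) (auto intro!: continuous_intros)
  then obtain v where vseg: "\<And>n. v n \<in> closed_segment (x n) (x n + u n)"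
    and vmax: "\<And>n z. z \<in> closed_segment (x n) (x n + u n) \<Longrightarrow>
      norm (?q' z - ?q' (x n)) \<le> norm (?q' (v n) - ?q' (x n))"
    by metis
  have "norm (v n - x n) \<le> norm (u n)" for n
    using segment_bound1[OF vseg[of n]] by simp
  then have "norm (v n / x n - 1) \<le> norm (u n / x n)" if "x n \<noteq> 0" for n
  proof -
    have "v n / x n - 1 = (v n - x n) / x n"
      using that by (simp add: diff_divide_distrib)
    then show ?thesis
      using \<open>norm (v n - x n) \<le> norm (u n)\<close> by (simp add: norm_divide divide_right_mono)
  qed
  then have "((\<lambda>n. v n / x n - 1) \<longlongrightarrow> 0) F"
    by (intro Lim_null_comparison[OF _ ux] eventually_mono[OF x0]) blast
  then have "((\<lambda>n. v n / x n) \<longlongrightarrow> 1) F"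
    by (simp add: LIM_zero_iff)
  then have "((\<lambda>n. ?q' (v n) / ?q' (x n)) \<longlongrightarrow> 1) F"
    by (rule poly_ratio_tendsto_1[OF q'0 x])
  then have lim: "((\<lambda>n. norm (?q' (v n) / ?q' (x n) - 1)) \<longlongrightarrow> 0) F"
    by (simp add: tendsto_norm_zero_iff LIM_zero_iff)
  have bound: "norm (poly q (x n + u n) - poly q (x n) - u n * ?q' (x n))
      \<le> norm (?q' (v n) / ?q' (x n) - 1)" if q'x: "?q' (x n) \<noteq> 0" for n
  proof -
    let ?h = "\<lambda>z. poly q z - z * ?q' (x n)"
    have "norm (?h (x n + u n) - ?h (x n))
        \<le> norm (?q' (v n) - ?q' (x n)) * norm (x n + u n - x n)"
    proof (rule field_differentiable_bound)
      show "convex (closed_segment (x n) (x n + u n))"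
        by (rule convex_closed_segment)
      show "(?h has_field_derivative ?q' z - ?q' (x n))
          (at z within closed_segment (x n) (x n + u n))" for z
        by (auto intro!: derivative_eq_intros)
    qed (use vmax in auto)
    also have "\<dots> = norm (?q' (v n) / ?q' (x n) - 1)"
      using q'x by (simp add: u diff_divide_distrib flip: norm_divide)
    finally show ?thesis by (simp add: algebra_simps)
  qed
  show "((\<lambda>n. poly q (x n + u n) - poly q (x n) - u n * poly (pderiv q) (x n)) \<longlongrightarrow> 0) F"
    by (rule Lim_null_comparison[OF _ lim]) (use q'x0 bound in \<open>auto elim: eventually_mono\<close>)
qed

section \<open>Polynomials and exponentials\<close>

text \<open>If \<open>S = P exp(Q)\<close> were a polynomial, then \<open>S' P = S (P' + P Q')\<close>. On the left the degree
  drops below \<open>deg S + deg P\<close>, but on the right it does not, because \<open>P Q'\<close> dominates \<open>P'\<close>.\<close>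

lemma poly_times_exp_not_poly:
  fixes P Q S :: "complex poly"
  assumes "degree Q > 0" and "P \<noteq> 0"
  shows "\<exists>z. poly P z * exp (poly Q z) \<noteq> poly S z"
proof (rule ccontr)
  assume "\<not> ?thesis"
  then have eq: "poly S z = poly P z * exp (poly Q z)" for z
    by simp
  have deriv: "poly (pderiv S) z
      = poly (pderiv P) z * exp (poly Q z) + poly P z * (exp (poly Q z) * poly (pderiv Q) z)" for z
  proof (rule DERIV_unique)
    show "(poly S has_field_derivative poly (pderiv S) z) (at z)"
      by (rule poly_DERIV)
    show "(poly S has_field_derivative
        poly (pderiv P) z * exp (poly Q z) + poly P z * (exp (poly Q z) * poly (pderiv Q) z)) (at z)"
      unfolding eq[abs_def] by (auto intro!: derivative_eq_intros)
  qed
  let ?T = "pderiv P + P * pderiv Q"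
  have "poly (pderiv S * P) z = poly (S * ?T) z" for z
    by (simp add: deriv eq algebra_simps)
  then have ode: "pderiv S * P = S * ?T"
    by (simp add: poly_eq_poly_eq_iff[symmetric] fun_eq_iff)
  have Q'0: "pderiv Q \<noteq> 0"
    using \<open>degree Q > 0\<close> by (simp add: pderiv_eq_0_iff)
  have degT: "?T \<noteq> 0 \<and> degree P \<le> degree ?T"
  proof (cases "degree P = 0")
    case True
    then have "pderiv P = 0" by (simp add: pderiv_eq_0_iff)
    with True Q'0 \<open>P \<noteq> 0\<close> show ?thesis by simp
  next
    case False
    then have "degree (pderiv P) < degree (P * pderiv Q)"
      using Q'0 \<open>P \<noteq> 0\<close> by (simp add: degree_mult_eq degree_pderiv)
    then have "degree ?T = degree (P * pderiv Q)"
      by (rule degree_add_eq_right)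
    then show ?thesis
      using False Q'0 \<open>P \<noteq> 0\<close> by (auto simp: degree_mult_eq)
  qed
  have "S \<noteq> 0"
  proof
    assume "S = 0"
    with eq have "poly P z = poly 0 z" for z by simp
    with \<open>P \<noteq> 0\<close> show False by (metis poly_eq_poly_eq_iff ext)
  qed
  with degT ode have "pderiv S \<noteq> 0" by auto
  then have "degree (pderiv S) < degree S"
    by (simp add: pderiv_eq_0_iff degree_pderiv)
  then have "degree (pderiv S * P) < degree (S * ?T)"
    using \<open>pderiv S \<noteq> 0\<close> \<open>P \<noteq> 0\<close> \<open>S \<noteq> 0\<close> degT by (simp add: degree_mult_eq)
  with ode show False by simp
qed

text \<open>If the sublevel set is bounded, then \<open>f\<close> omits a disk about \<open>0\<close> near infinity. By
  Casorati-Weierstrass infinity is then at most a pole, so \<open>f\<close> is a polynomial.\<close>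

lemma unbounded_sublevel_if_not_poly:
  assumes holf: "f holomorphic_on UNIV" and "0 < R"
    and nonpoly: "\<And>p. \<exists>z. f z \<noteq> poly p z"
  shows "\<not> bounded {z. norm (f z) \<le> R}"
proof
  assume "bounded {z. norm (f z) \<le> R}"
  then obtain B where "0 < B" and B: "\<And>z. norm (f z) \<le> R \<Longrightarrow> norm z \<le> B"
    unfolding bounded_pos by auto
  \<comment> \<open>The inversion maps the punctured disk of radius \<open>1 / B\<close> onto the exterior of the disk of radius \<open>B\<close>.\<close>
  let ?M = "ball 0 (1 / B) :: complex set"
  have big: "R < norm (f (inverse w))" if "w \<in> ?M - {0}" for w
  proof (rule ccontr)
    assume "\<not> ?thesis"
    with B have "norm (inverse w) \<le> B" by force
    with that \<open>0 < B\<close> show False by (auto simp: norm_inverse norm_divide field_simps)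
  qed
  have "\<exists>l. (f \<longlongrightarrow> l) at_infinity \<or> ((inverse \<circ> f) \<longlongrightarrow> l) at_infinity"
  proof (rule ccontr)
    assume "\<not> ?thesis"
    then have "closure ((f \<circ> inverse) ` (?M - {0})) = UNIV"
      using \<open>0 < B\<close>
      by (intro Casorati_Weierstrass holomorphic_on_compose_gen[OF _ holf])
        (auto simp: lim_at_infinity_0 o_assoc intro!: holomorphic_intros)
    moreover have "(f \<circ> inverse) ` (?M - {0}) \<subseteq> - ball 0 R"
      using big by fastforce
    then have "closure ((f \<circ> inverse) ` (?M - {0})) \<subseteq> - ball 0 R"
      by (rule closure_minimal) (simp add: closed_Compl)
    ultimately show False using \<open>0 < R\<close> by (metis Compl_iff UNIV_I centre_in_ball subsetD)
  qed
  then consider l where "(f \<longlongrightarrow> l) at_infinity" | l where "((inverse \<circ> f) \<longlongrightarrow> l) at_infinity"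
    by blast
  then show False
  proof cases
    case 1
    then have "f z = poly [:l:] z" for z
      using Liouville_weak[OF holf] by simp
    with nonpoly show False by blast
  next
    case 2
    then obtain a n where "\<And>z. f z = (\<Sum>i\<le>n. a i * z ^ i)"
      using pole_at_infinity[OF holf] by blast
    then have "f z = poly (\<Sum>i\<le>n. monom (a i) i) z" for z
      by (simp add: poly_sum poly_monom)
    with nonpoly show False by blast
  qed
qed

lemma exp_bounded_away_from_1_on_unit_circle:
  obtains \<delta> where "\<delta> > 0" and "\<And>w::complex. norm w = 1 \<Longrightarrow> \<delta> \<le> norm (exp w - 1)"
proof -
  have "\<exists>w\<in>sphere (0::complex) 1. \<forall>v\<in>sphere (0::complex) 1. norm (exp w - 1) \<le> norm (exp v - 1)"
    by (rule continuous_attains_inf) (auto intro!: continuous_intros)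
  then obtain w :: complex where w: "norm w = 1"
    and min: "\<And>v::complex. norm v = 1 \<Longrightarrow> norm (exp w - 1) \<le> norm (exp v - 1)"
    by (metis mem_sphere_0)
  have "exp w \<noteq> 1"
  proof
    assume "exp w = 1"
    then obtain n :: int where "Re w = 0" and n: "Im w = of_int (2 * n) * pi"
      by (auto simp: exp_eq_1)
    with w have "\<bar>Im w\<bar> = 1" by (simp add: cmod_eq_Im)
    then have "2 * \<bar>real_of_int n\<bar> * pi = 1" by (simp add: n abs_mult)
    moreover have "n = 0 \<or> 1 \<le> \<bar>real_of_int n\<bar>" by linarith
    moreover have "2 * pi \<le> 2 * \<bar>real_of_int n\<bar> * pi" if "1 \<le> \<bar>real_of_int n\<bar>"
      using that by simp
    ultimately show False using pi_gt3 by auto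
  qed
  with min show thesis by (intro that[of "norm (exp w - 1)"]) auto
qed

text \<open>The radius is \<open>1 / |Q'(z)|\<close>. Suppose that for arbitrarily large \<open>z\<close> both \<open>z\<close> and some
  \<open>z + u(z)\<close> at this distance belong to the sublevel set. As \<open>z\<close> goes to infinity along these points,
  \<open>g = P\<^sub>1 exp(Q) / P\<^sub>2\<close> tends to \<open>-1\<close> at both of them, so \<open>g(z + u(z)) / g(z)\<close> tends to \<open>1\<close>. But
  this quotient is asymptotic to \<open>exp(u(z) Q'(z))\<close>, whose exponent has modulus \<open>1\<close>.\<close>

lemma far_sublevel_points_encircled:
  fixes P1 P2 Q :: "complex poly"
  defines "f \<equiv> \<lambda>z. poly P1 z * exp (poly Q z) + poly P2 z"
  assumes Q: "degree Q > 0" and P2: "degree P2 > 0" and P1: "P1 \<noteq> 0"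
  obtains \<rho> where "\<And>z. \<rho> \<le> norm z \<Longrightarrow> norm (f z) \<le> R \<Longrightarrow>
      \<exists>r>0. \<forall>w\<in>sphere z r. R < norm (f w)"
proof -
  let ?r = "\<lambda>z. 1 / norm (poly (pderiv Q) z)"
  define A where "A = {z. norm (f z) \<le> R \<and> (\<exists>w\<in>sphere z (?r z). norm (f w) \<le> R)}"
  \<comment> \<open>\<open>A\<close> consists of the points where the circle fails. Limits along \<open>F\<close> are limits at infinity within
    \<open>A\<close>; the aim is that \<open>F\<close> is the trivial filter, so that \<open>A\<close> is bounded.\<close>
  define F where "F = inf at_infinity (principal A)"
  obtain u where u: "\<And>z. norm (u z) = ?r z"
    and uA: "\<And>z. z \<in> A \<Longrightarrow> norm (f (z + u z)) \<le> R"
  proof -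
    have "\<exists>c. norm c = ?r z \<and> (z \<in> A \<longrightarrow> norm (f (z + c)) \<le> R)" for z :: complex
    proof (cases "z \<in> A")
      case True
      then obtain w where "w \<in> sphere z (?r z)" "norm (f w) \<le> R" by (auto simp: A_def)
      then show ?thesis
        by (intro exI[of _ "w - z"]) (auto simp: dist_norm norm_minus_commute)
    next
      case False
      have "norm (complex_of_real (?r z)) = ?r z"
        unfolding norm_of_real by simp
      with False show ?thesis by blast
    qed
    then have "\<exists>u. \<forall>z. norm (u z) = ?r z \<and> (z \<in> A \<longrightarrow> norm (f (z + u z)) \<le> R)"
      by (intro choice allI)
    then show thesis using that by blast
  qed
  have FA: "\<forall>\<^sub>F z in F. z \<in> A"
    by (simp add: F_def eventually_inf_principal)
  then have fx: "\<forall>\<^sub>F z in F. norm (f z) \<le> R"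
    by eventually_elim (simp add: A_def)
  from FA have fy: "\<forall>\<^sub>F z in F. norm (f (z + u z)) \<le> R"
    by eventually_elim (rule uA)
  have x: "filterlim (\<lambda>z. z) at_infinity F"
    unfolding F_def filterlim_def by simp
  note incr = poly_increment_linear[OF Q x u]
  have x0: "\<forall>\<^sub>F z in F. z \<noteq> 0"
    using x by (rule filterlim_at_infinity_imp_eventually_ne)
  have "((\<lambda>z. 1 + u z / z) \<longlongrightarrow> 1 + 0) F"
    by (intro tendsto_intros incr(1))
  then have shift: "((\<lambda>z. (z + u z) / z) \<longlongrightarrow> 1) F"
    unfolding add_0_right
    by (rule Lim_transform_eventually) (use x0 in \<open>auto elim!: eventually_mono simp: field_simps\<close>)
  have "filterlim (\<lambda>z. (z + u z) / z * z) at_infinity F"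
    by (rule tendsto_mult_filterlim_at_infinity[OF shift _ x]) simp
  then have y: "filterlim (\<lambda>z. z + u z) at_infinity F"
    by (rule filterlim_mono_eventually[OF _ order_refl order_refl])
      (use x0 in eventually_elim, simp)
  let ?g = "\<lambda>z. poly P1 z * exp (poly Q z) / poly P2 z"
  have g: "((\<lambda>z. ?g (h z)) \<longlongrightarrow> -1) F"
    if h: "filterlim h at_infinity F" and hR: "\<forall>\<^sub>F z in F. norm (f (h z)) \<le> R" for h
  proof -
    have P2h: "filterlim (\<lambda>z. poly P2 (h z)) at_infinity F"
      by (rule filterlim_compose[OF filterlim_poly_at_infinity[OF P2] h])
    have "((\<lambda>z. f (h z) * inverse (poly P2 (h z))) \<longlongrightarrow> 0) F"
    proof (rule tendsto_0_le[where K = R])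
      show "((\<lambda>z. inverse (poly P2 (h z))) \<longlongrightarrow> 0) F"
        using P2h by (rule filterlim_compose[OF tendsto_inverse_0])
      show "\<forall>\<^sub>F z in F. norm (f (h z) * inverse (poly P2 (h z))) \<le> norm (inverse (poly P2 (h z))) * R"
        using hR by eventually_elim (simp add: norm_mult mult.commute mult_right_mono)
    qed
    then have "((\<lambda>z. f (h z) * inverse (poly P2 (h z)) - 1) \<longlongrightarrow> 0 - 1) F"
      by (intro tendsto_intros)
    moreover have "\<forall>\<^sub>F z in F. f (h z) * inverse (poly P2 (h z)) - 1 = ?g (h z)"
      using filterlim_at_infinity_imp_eventually_ne[OF P2h, of 0]
      by eventually_elim (simp add: f_def field_simps)
    ultimately show ?thesis by (simp add: Lim_transform_eventually)
  qed
  have nz: "\<forall>\<^sub>F z in F. poly p (h z) \<noteq> 0"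
    if "p \<noteq> 0" "filterlim h at_infinity F" for p :: "complex poly" and h
    using eventually_poly_neq_0_at_infinity[OF that(1)] that(2) by (rule eventually_compose_filterlim)
  have "P2 \<noteq> 0" using P2 by auto
  \<comment> \<open>Removing from \<open>g(z + u z) / g(z)\<close> the rational factors and the exponential of the nonlinear part of
    the increment of \<open>Q\<close>, all of which have limit \<open>1\<close>, leaves \<open>exp(u z * Q' z)\<close>.\<close>
  have g_lim: "((\<lambda>z. ?g (z + u z) / ?g z) \<longlongrightarrow> (-1) / (-1)) F"
    by (intro tendsto_divide g x y fx fy) simp
  have P1_lim: "((\<lambda>z. poly P1 (z + u z) / poly P1 z) \<longlongrightarrow> 1) F"
    using P1 by (rule poly_ratio_tendsto_1[OF _ x shift])
  have P2_lim: "((\<lambda>z. poly P2 (z + u z) / poly P2 z) \<longlongrightarrow> 1) F"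
    using P2 by (intro poly_ratio_tendsto_1[OF _ x shift]) auto
  have exp_lim: "((\<lambda>z. exp (- (poly Q (z + u z) - poly Q z - u z * poly (pderiv Q) z)))
      \<longlongrightarrow> exp (- 0)) F"
    by (intro tendsto_intros incr(2))
  have "((\<lambda>z. (?g (z + u z) / ?g z)
        / (poly P1 (z + u z) / poly P1 z) * (poly P2 (z + u z) / poly P2 z)
        * exp (- (poly Q (z + u z) - poly Q z - u z * poly (pderiv Q) z)))
      \<longlongrightarrow> (-1) / (-1) / 1 * 1 * exp (- 0)) F"
    by (rule tendsto_mult[OF tendsto_mult[OF tendsto_divide[OF g_lim P1_lim] P2_lim] exp_lim]) simp
  moreover have "\<forall>\<^sub>F z in F. (?g (z + u z) / ?g z)
        / (poly P1 (z + u z) / poly P1 z) * (poly P2 (z + u z) / poly P2 z)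
        * exp (- (poly Q (z + u z) - poly Q z - u z * poly (pderiv Q) z))
      = exp (u z * poly (pderiv Q) z)"
    using nz[OF P1 x] nz[OF P1 y] nz[OF \<open>P2 \<noteq> 0\<close> x] nz[OF \<open>P2 \<noteq> 0\<close> y]
    by eventually_elim (simp add: exp_diff exp_minus exp_add field_simps)
  ultimately have lim: "((\<lambda>z. exp (u z * poly (pderiv Q) z)) \<longlongrightarrow> 1) F"
    by (auto dest: Lim_transform_eventually)
  obtain \<delta> where "\<delta> > 0" and \<delta>: "\<And>w::complex. norm w = 1 \<Longrightarrow> \<delta> \<le> norm (exp w - 1)"
    using exp_bounded_away_from_1_on_unit_circle by blast
  have Q'0: "pderiv Q \<noteq> 0" using Q by (simp add: pderiv_eq_0_iff)
  have "\<forall>\<^sub>F z in F. False"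
    using tendstoD[OF lim \<open>\<delta> > 0\<close>] nz[OF Q'0 x]
  proof eventually_elim
    case (elim z)
    then have "norm (u z * poly (pderiv Q) z) = 1" by (simp add: norm_mult u)
    from \<delta>[OF this] elim show ?case by (simp add: dist_norm)
  qed
  then have "\<forall>\<^sub>F z in at_infinity. z \<notin> A"
    by (simp add: F_def eventually_inf_principal)
  moreover have "\<forall>\<^sub>F z in at_infinity. poly (pderiv Q) z \<noteq> 0"
    by (rule eventually_poly_neq_0_at_infinity[OF Q'0])
  ultimately have "\<forall>\<^sub>F z in at_infinity. norm (f z) \<le> R \<longrightarrow>
      (\<exists>r>0. \<forall>w\<in>sphere z r. R < norm (f w))"
  proof eventually_elim
    case (elim z)
    then show ?case by (intro impI exI[of _ "?r z"]) (auto simp: A_def not_le)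
  qed
  then show thesis using that by (auto simp: eventually_at_infinity)
qed

section \<open>Sublevel sets\<close>

text \<open>A closed set that separates two points of the plane has a component that separates them.
  Here the component is bounded, so at most one of the two points can be in the unbounded region of its
  complement; the maximum principle applies to the region of the other one.\<close>

lemma connected_superlevel:
  assumes holf: "f holomorphic_on UNIV"
    and bdd: "\<And>C. C \<in> components {z. norm (f z) \<le> R} \<Longrightarrow> bounded C"
  shows "connected {z. R < norm (f z)}"
proof (rule ccontr)
  let ?K = "{z. norm (f z) \<le> R}"
  have contf: "continuous_on UNIV f"
    using holf by (rule holomorphic_on_imp_continuous_on)
  have "closed ?K"
    by (intro closed_Collect_le continuous_intros contf)
  have compl: "- ?K = {z. R < norm (f z)}" by auto
  assume "\<not> connected {z. R < norm (f z)}"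
  then obtain a b where ab: "a \<in> - ?K" "b \<in> - ?K" "\<not> connected_component (- ?K) a b"
    unfolding connected_iff_connected_component compl by blast
  then obtain C where C: "C \<in> components ?K" and sep: "\<not> connected_component (- C) a b"
    using separation_by_component_closed_pointwise[OF \<open>closed ?K\<close>] by blast
  have "C \<subseteq> ?K" using C by (rule in_components_subset)
  have "closed C" using closed_components[OF \<open>closed ?K\<close> C] .
  have unbdd: "\<not> bounded (connected_component_set (- C) c)" if c: "c \<in> - ?K" for c
  proof
    let ?W = "connected_component_set (- C) c"
    assume W: "bounded ?W"
    have "?W \<in> components (- C)"
      using c \<open>C \<subseteq> ?K\<close> by (intro componentsI) auto
    then have fr: "frontier ?W \<subseteq> ?K"
      using frontier_of_components_closed_complement[OF \<open>closed C\<close>] \<open>C \<subseteq> ?K\<close> by blast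
    have "c \<in> ?W" using c \<open>C \<subseteq> ?K\<close> by (auto intro: connected_component_refl)
    moreover have "f holomorphic_on interior ?W" "continuous_on (closure ?W) f"
      using holf contf by (auto intro: holomorphic_on_subset continuous_on_subset)
    moreover have "norm (f z) \<le> R" if "z \<in> frontier ?W" for z
      using fr that by blast
    ultimately have "norm (f c) \<le> R"
      using maximum_modulus_frontier[of f ?W R c] W by blast
    with c show False by simp
  qed
  have "connected_component_set (- C) a = connected_component_set (- C) b"
    using bdd[OF C] unbdd ab by (intro cobounded_unique_unbounded_component) auto
  moreover have "b \<in> - C" using ab \<open>C \<subseteq> ?K\<close> by auto
  ultimately show False using sep by (metis connected_component_refl mem_Collect_eq)
qed

text \<open>A circle that misses \<open>K\<close> confines the component of its centre to the disk.\<close>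

lemma bounded_component_if_far_points_encircled:
  fixes K :: "'a::euclidean_space set"
  assumes enc: "\<And>z. z \<in> K \<Longrightarrow> \<rho> \<le> norm z \<Longrightarrow> \<exists>r>0. sphere z r \<inter> K = {}"
    and C: "C \<in> components K"
  shows "bounded C"
proof (cases "C \<subseteq> ball 0 \<rho>")
  case True
  then show ?thesis by (rule bounded_subset[OF bounded_ball])
next
  case False
  then obtain z where z: "z \<in> C" "\<rho> \<le> norm z" by (meson mem_ball_0 not_le subsetI)
  then obtain r where "r > 0" and r: "sphere z r \<inter> K = {}"
    using enc in_components_subset[OF C] by blast
  have "C \<subseteq> ball z r"
  proof (rule ccontr)
    assume "\<not> C \<subseteq> ball z r"
    moreover have "z \<in> C \<inter> ball z r" using z \<open>r > 0\<close> by simp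
    ultimately have "C \<inter> frontier (ball z r) \<noteq> {}"
      using in_components_connected[OF C] by (intro connected_Int_frontier) auto
    with r in_components_subset[OF C] \<open>r > 0\<close> show False by auto
  qed
  then show ?thesis by (rule bounded_subset[OF bounded_ball])
qed

text \<open>Every component of the complement in the plane is compact, so by the theorem of Sura-Bura it lies
  in a compact relatively open subset of the complement. In the sphere such a set is still clopen in the
  complement, and it does not contain infinity. So the component of infinity is a single point. If
  there were finitely many components, this point would be isolated, and the complement in the plane would be
  compact.\<close>

lemma infinitely_connected_if_complement_components_bounded:
  assumes "open U" "connected U" "U \<noteq> {}" and unbdd: "\<not> bounded (- U)"
    and bdd: "\<And>C. C \<in> components (- U) \<Longrightarrow> bounded C"
  shows "infinitely_connected U"
proof -
  let ?K = "- U"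
  let ?Y = "subtopology riemann_sphere (topspace riemann_sphere - Some ` U)"
  have clK: "closed ?K" using \<open>open U\<close> by (simp add: closed_def)
  have topY: "topspace ?Y = insert None (Some ` ?K)"
    by auto
  have False if fin: "finite (connected_components_of ?Y)"
  proof -
    let ?T = "connected_component_of_set ?Y None"
    have T: "?T \<in> connected_components_of ?Y"
      using topY by (auto simp: connected_components_of_def)
    have "Some x \<notin> ?T" for x
    proof
      assume xT: "Some x \<in> ?T"
      then have "x \<in> ?K"
        using connected_component_of_subset_topspace[of ?Y None] topY by auto
      let ?C = "connected_component_set ?K x"
      have C: "?C \<in> components ?K" using \<open>x \<in> ?K\<close> by (rule componentsI)
      have "compact ?C"
        using bdd[OF C] closed_components[OF clK C] by (simp add: compact_eq_bounded_closed)
      then obtain K where K: "openin (top_of_set ?K) K" "compact K" "?C \<subseteq> K"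
        using Sura_Bura_clopen_subset[OF closed_imp_locally_compact[OF clK] C _ open_UNIV] by auto
      have "K \<subseteq> ?K" using K(1) by (rule openin_imp_subset)
      have "closedin riemann_sphere (Some ` K)"
        using K(2) by (simp add: compact_imp_closed)
      then have "closedin ?Y (Some ` K)"
        using \<open>K \<subseteq> ?K\<close> by (intro closedin_subset_topspace) auto
      moreover have "openin ?Y (Some ` K)"
      proof -
        obtain V where V: "open V" "K = ?K \<inter> V"
          using K(1) by (auto simp: openin_open)
        then have "Some ` K = Some ` V \<inter> (topspace riemann_sphere - Some ` U)"
          by auto
        then show ?thesis
          using V(1) by (simp add: openin_subtopology_Int)
      qed
      moreover have "connectedin ?Y ?T" by (rule connectedin_connected_component_of)
      ultimately have "?T \<subseteq> Some ` K \<or> disjnt ?T (Some ` K)"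
        by (intro connectedin_clopen_cases)
      moreover have "None \<in> ?T"
        using topY by (simp add: connected_component_of_refl)
      moreover have "Some x \<in> Some ` K"
        using K(3) \<open>x \<in> ?K\<close> by (auto intro: connected_component_refl)
      ultimately show False using xT by (auto simp: disjnt_iff)
    qed
    moreover have "None \<in> ?T"
      using topY by (simp add: connected_component_of_refl)
    ultimately have "?T = {None}"
      by (intro set_eqI) (metis not_None_eq singleton_iff)
    moreover have "openin ?Y ?T"
      using open_in_finite_connected_components[OF fin T] .
    ultimately have "closedin ?Y (topspace ?Y - {None})" by (metis closedin_diff closedin_topspace)
    moreover have "topspace ?Y - {None} = Some ` ?K" unfolding topY by auto
    ultimately have "closedin ?Y (Some ` ?K)" by simp
    moreover have "closedin riemann_sphere (topspace riemann_sphere - Some ` U)"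
      using \<open>open U\<close> by (intro closedin_diff closedin_topspace) simp
    ultimately have "closedin riemann_sphere (Some ` ?K)"
      by (rule closedin_trans_full)
    then have "compact ?K" by simp
    with unbdd show False by (simp add: compact_imp_bounded)
  qed
  with assms show ?thesis by (auto simp: infinitely_connected_def)
qed

section \<open>The Baker omitted value\<close>

lemma has_bov_if_sublevel:
  assumes holf: "f holomorphic_on UNIV" and "0 < R"
    and bdd: "\<And>C. C \<in> components {z. norm (f z) \<le> R} \<Longrightarrow> bounded C"
    and unbdd: "\<not> bounded {z. norm (f z) \<le> R}"
  shows "has_bov f"
proof -
  let ?U = "{z. R < norm (f z)}" and ?K = "{z. norm (f z) \<le> R}"
  have contf: "continuous_on UNIV f"
    using holf by (rule holomorphic_on_imp_continuous_on)
  have compl: "- ?U = ?K" by auto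
  have "open ?U" by (intro open_Collect_less continuous_intros contf)
  have "?U \<noteq> {}"
  proof
    assume "?U = {}"
    then have "?K = UNIV" using compl by auto
    with bdd[of UNIV] unbdd show False by (simp add: components_eq_sing_iff[THEN iffD2] connected_UNIV)
  qed
  have conn: "infinitely_connected ?U"
    using \<open>open ?U\<close> connected_superlevel[OF holf bdd] \<open>?U \<noteq> {}\<close> unbdd bdd
    by (intro infinitely_connected_if_complement_components_bounded) (simp_all add: compl)
  have front: "bounded D" if D: "D \<in> components (frontier ?U)" for D
  proof -
    have "closed ?K" using \<open>open ?U\<close> unfolding compl[symmetric] by (rule closed_Compl)
    then have "frontier ?U \<subseteq> ?K"
      using frontier_subset_closed[of ?K] frontier_complement[of ?U] unfolding compl by simp
    then have "D \<subseteq> ?K" using in_components_subset[OF D] by blast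
    then obtain C where "C \<in> components ?K" "D \<subseteq> C"
      using exists_component_superset[of D ?K] in_components_connected[OF D]
        in_components_nonempty[OF D] by blast
    then show ?thesis using bdd bounded_subset by blast
  qed
  let ?r = "2 * arcsin (1 / sqrt (1 + R\<^sup>2))"
  have "1 < sqrt (1 + R\<^sup>2)" using \<open>0 < R\<close> by simp
  then have s: "0 < 1 / sqrt (1 + R\<^sup>2)" "1 / sqrt (1 + R\<^sup>2) < 1"
    by (simp_all only: zero_less_divide_1_iff divide_less_eq_1 less_trans[OF zero_less_one]) simp
  have "0 < 2 * arcsin t" "2 * arcsin t < pi" if "0 < t" "t < 1" for t :: real
    using that arcsin_less_arcsin[of 0 t] arcsin_less_arcsin[of t 1] by auto
  then have "0 < ?r" "?r < pi" using s by blast+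
  moreover have "{z. Some (f z) \<in> spherical_ball None ?r} = ?U"
    using \<open>0 < R\<close> Some_in_spherical_ball_None[of R] by auto
  ultimately show ?thesis
    using holf conn front
    unfolding has_bov_def baker_omitted_value_def omitted_value_def Let_def
    by (intro conjI exI[of _ ?r]) simp_all
qed

theorem theorem1p1:
  fixes Q1 P1 P2 :: "complex poly"
  assumes "degree Q1 > 0" and "degree P2 > 0" and "P1 \<noteq> 0"
  shows "has_bov (\<lambda>z. poly P1 z * exp (poly Q1 z) + poly P2 z)"
proof (rule has_bov_if_sublevel[where R = 1])
  let ?f = "\<lambda>z. poly P1 z * exp (poly Q1 z) + poly P2 z"
  show holf: "?f holomorphic_on UNIV"
    by (intro holomorphic_intros)
  show "bounded C" if C: "C \<in> components {z. norm (?f z) \<le> 1}" for C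
  proof -
    obtain \<rho> where \<rho>: "\<And>z. \<rho> \<le> norm z \<Longrightarrow> norm (?f z) \<le> 1 \<Longrightarrow>
        \<exists>r>0. \<forall>w\<in>sphere z r. 1 < norm (?f w)"
      using far_sublevel_points_encircled[OF assms] by blast
    have "\<exists>r>0. sphere z r \<inter> {z. norm (?f z) \<le> 1} = {}"
      if "z \<in> {z. norm (?f z) \<le> 1}" "\<rho> \<le> norm z" for z
      using \<rho>[of z] that by (force simp: not_le[symmetric])
    then show ?thesis
      using bounded_component_if_far_points_encircled[OF _ C] by blast
  qed
  show "\<not> bounded {z. norm (?f z) \<le> 1}"
  proof (rule unbounded_sublevel_if_not_poly[OF holf])
    show "\<exists>z. ?f z \<noteq> poly p z" for p
      using poly_times_exp_not_poly[OF assms(1,3), of "p - P2"] by (auto simp: algebra_simps)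
  qed simp
qed simp

end
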